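(* Let $\Gamma=(V,H)$ be an oriented hypergraph on $n$ vertices with no vertex of degree zero, and let $\lambda_1\le\dots\le\lambda_n$ be the eigenvalues of its normalized Laplacian $L$. If $f$ is an eigenfunction of $L$ for the eigenvalue $\lambda_k$ and $\lambda_k$ has multiplicity $r$, then the number of nodal domains of $f$ is at most $k+r-1$.
   Context: An oriented hypergraph is a pair $\Gamma=(V,H)$ where $V$ is a finite vertex set and each hyperedge $h\in H$ is a pair $(h_{in},h_{out})$ of disjoint subsets of $V$ (inputs and outputs); $h$ is identified with $h_{in}\cup h_{out}$ when convenient. $\deg(i)$ is the number of hyperedges containing $i$. The normalized Laplacian acts on $f:V\to\mathbb{R}$ by $$Lf(i)=\frac{1}{\deg(i)}\Big[\sum_{h:\,i\in h_{in}}\Big(\sum_{i'\in h_{in}}f(i')-\sum_{j'\in h_{out}}f(j')\Big)-\sum_{h:\,i\in h_{out}}\Big(\sum_{i'\in h_{in}}f(i')-\sum_{j'\in h_{out}}f(j')\Big)\Big];$$ it is self-adjoint for $(f,g)=\sum_i\deg(i)f(i)g(i)$, with real eigenvalues listed with multiplicity as $\lambda_1\le\dots\le\lambda_n$. A hypergraph $(W,K)$ is connected on a vertex subset if any two vertices are joined by a sequence of vertices in which consecutive vertices lie in a common hyperedge; connected components are the maximal such vertex sets. Let $\mathrm{supp}(f)=\{i\in V: f(i)\neq 0\}$. A nodal domain of $f$ is (the vertex set of) a connected component of the hypergraph with vertex set $\mathrm{supp}(f)$ and hyperedge set $\{h\cap\mathrm{supp}(f): h\in H\}$. *)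

theory Defs
  imports "HOL-Analysis.Analysis" "HOL-Library.Multiset"
begin

text \<open>The finite vertex set is the universe of a type of class \<^class>\<open>finite\<close>, so that
  \<open>n = CARD('v)\<close> and functions on the vertices are vectors in \<open>real ^ 'v\<close>.
  A hyperedge is a pair \<open>(inputs, outputs)\<close>.\<close>

type_synonym 'v hyperedge = "'v set \<times> 'v set"

definition oriented_hypergraph :: "'v::finite hyperedge set \<Rightarrow> bool" where
  "oriented_hypergraph H \<longleftrightarrow> (\<forall>h\<in>H. fst h \<inter> snd h = {})"

definition verts :: "'v hyperedge \<Rightarrow> 'v set" where
  "verts h = fst h \<union> snd h"

definition deg :: "'v::finite hyperedge set \<Rightarrow> 'v \<Rightarrow> nat" where
  "deg H i = card {h \<in> H. i \<in> verts h}"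

definition edge_diff :: "'v::finite hyperedge \<Rightarrow> real ^ 'v \<Rightarrow> real" where
  "edge_diff h f = (\<Sum>i\<in>fst h. f $ i) - (\<Sum>j\<in>snd h. f $ j)"

definition laplacian :: "'v::finite hyperedge set \<Rightarrow> real ^ 'v \<Rightarrow> real ^ 'v" where
  "laplacian H f = (\<chi> i. 1 / real (deg H i) *
     ((\<Sum>h\<in>{h \<in> H. i \<in> fst h}. edge_diff h f) - (\<Sum>h\<in>{h \<in> H. i \<in> snd h}. edge_diff h f)))"


definition eigenspace :: "(real ^ 'v \<Rightarrow> real ^ 'v) \<Rightarrow> real \<Rightarrow> (real ^ 'v) set" where
  "eigenspace T \<mu> = {f. T f = \<mu> *\<^sub>R f}"

definition eigenfunction :: "(real ^ 'v \<Rightarrow> real ^ 'v) \<Rightarrow> real \<Rightarrow> real ^ 'v \<Rightarrow> bool" where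
  "eigenfunction T \<mu> f \<longleftrightarrow> f \<noteq> 0 \<and> T f = \<mu> *\<^sub>R f"

definition eigenvalues :: "(real ^ 'v \<Rightarrow> real ^ 'v) \<Rightarrow> real set" where
  "eigenvalues T = {\<mu>. \<exists>f. eigenfunction T \<mu> f}"

text \<open>The Laplacian is self-adjoint for a positive definite form when no degree vanishes, so
  geometric and algebraic multiplicities agree, all eigenvalues are real, and the multiplicities
  add up to \<open>n\<close>.\<close>

definition multiplicity_of :: "(real ^ 'v::finite \<Rightarrow> real ^ 'v) \<Rightarrow> real \<Rightarrow> nat" where
  "multiplicity_of T \<mu> = dim (eigenspace T \<mu>)"

definition eigenvalue_list :: "(real ^ 'v::finite \<Rightarrow> real ^ 'v) \<Rightarrow> real list" where
  "eigenvalue_list T = sorted_list_of_multiset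
     (\<Sum>\<mu>\<in>eigenvalues T. replicate_mset (multiplicity_of T \<mu>) \<mu>)"

text \<open>Indices start at 1: \<open>nth_eigenvalue T 1\<close> is the smallest eigenvalue.\<close>

definition nth_eigenvalue :: "(real ^ 'v::finite \<Rightarrow> real ^ 'v) \<Rightarrow> nat \<Rightarrow> real" where
  "nth_eigenvalue T k = eigenvalue_list T ! (k - 1)"


text \<open>In a hypergraph \<open>(W, K)\<close>, the joining sequences stay inside the subset \<open>S\<close>. A vertex is
  joined to itself by a one-element sequence, so a vertex lying in no hyperedge still forms a
  component.\<close>

definition connected_on :: "'v set set \<Rightarrow> 'v set \<Rightarrow> bool" where
  "connected_on K S \<longleftrightarrow>
     (\<forall>x\<in>S. \<forall>y\<in>S. (x, y) \<in> {(u, v). u \<in> S \<and> v \<in> S \<and> (\<exists>h\<in>K. u \<in> h \<and> v \<in> h)}\<^sup>*)"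

definition connected_comps :: "'v set \<Rightarrow> 'v set set \<Rightarrow> 'v set set" where
  "connected_comps W K =
     {S. S \<noteq> {} \<and> S \<subseteq> W \<and> connected_on K S \<and>
         (\<forall>S'. S \<subseteq> S' \<and> S' \<subseteq> W \<and> connected_on K S' \<longrightarrow> S' = S)}"

definition supp :: "real ^ 'v \<Rightarrow> 'v set" where
  "supp f = {i. f $ i \<noteq> 0}"

definition nodal_domains :: "'v hyperedge set \<Rightarrow> real ^ 'v \<Rightarrow> 'v set set" where
  "nodal_domains H f = connected_comps (supp f) ((\<lambda>h. verts h \<inter> supp f) ` H)"

end

theory Submission
  imports Defs
begin

text \<open>The restrictions of \<open>f\<close> to its nodal domains are linearly independent, and since no hyperedge
  meets two nodal domains, the Rayleigh quotient of every nonzero element of their span equals the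
  eigenvalue \<open>\<lambda>\<close> of \<open>f\<close>. On the other hand, the Rayleigh quotient exceeds \<open>\<lambda>\<close> on the orthogonal
  complement of the eigenspaces for eigenvalues \<open>\<le> \<lambda>\<close>, and these have total dimension at most
  \<open>k + r - 1\<close>. If there were more nodal domains, the two subspaces would intersect nontrivially.\<close>

section \<open>Auxiliary facts on quadratic polynomials and dimensions\<close>

text \<open>The polynomial has its minimum at \<open>t = 0\<close>, where its derivative is
  \<open>a\<close>. This is the first-order condition for a minimizer of the Rayleigh
  quotient.\<close>

lemma quadratic_nonneg_linear_coeff_zero:
  fixes a c :: real
  assumes "\<And>t. 0 \<le> a * t + c * t\<^sup>2" and "0 \<le> c"
  shows "a = 0"
proof (rule ccontr)
  assume "a \<noteq> 0"
  \<comment> \<open>Evaluating at \<open>- s\<close> gives exactly \<open>- s\<^sup>2\<close>; the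
    summand 1 keeps the denominator positive even for \<open>c = 0\<close>.\<close>
  define s where "s = a / (c + 1)"
  have a: "a = s * (c + 1)"
    using \<open>0 \<le> c\<close> by (simp add: s_def)
  have "0 \<le> a * (- s) + c * (- s)\<^sup>2"
    by (rule assms(1))
  also have "\<dots> = - s\<^sup>2"
    unfolding a by (simp add: algebra_simps power2_eq_square)
  finally have "s = 0" by simp
  then show False
    using \<open>a \<noteq> 0\<close> a by simp
qed

lemma dim_UN_le:
  fixes E :: "'b \<Rightarrow> 'a::euclidean_space set"
  assumes "finite A"
  shows "dim (\<Union>i\<in>A. E i) \<le> (\<Sum>i\<in>A. dim (E i))"
  using assms
proof (induction A)
  case empty
  then show ?case by simp
next
  case (insert i A)
  have "dim (\<Union>j\<in>insert i A. E j) \<le> dim (E i) + dim (\<Union>j\<in>A. E j)"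
  proof -
    have "dim (E i \<union> (\<Union>j\<in>A. E j)) = dim {x + y |x y. x \<in> span (E i) \<and> y \<in> span (\<Union>j\<in>A. E j)}"
      by (simp flip: span_Un)
    also have "\<dots> \<le> dim (span (E i)) + dim (span (\<Union>j\<in>A. E j))"
      using dim_sums_Int[OF subspace_span subspace_span, of "E i" "\<Union>j\<in>A. E j"] by linarith
    finally show ?thesis by simp
  qed
  with insert show ?case by simp
qed

section \<open>Operators that are self-adjoint for a positive definite form\<close>

text \<open>\<open>W\<close> encodes the form \<open>(x, y) = W x \<bullet> y\<close>, so that
  \<open>T\<close> can be self-adjoint for it while all computations use the standard inner
  product.\<close>

locale form_selfadjoint =
  fixes W T :: "real ^ 'v::finite \<Rightarrow> real ^ 'v"
  assumes linear_W: "linear W" and linear_T: "linear T"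
    and W_sym: "W x \<bullet> y = x \<bullet> W y"
    and W_pos: "x \<noteq> 0 \<Longrightarrow> 0 < W x \<bullet> x"
    and T_selfadjoint: "W (T x) \<bullet> y = W x \<bullet> T y"
begin

lemmas W_simps = linear_0[OF linear_W] linear_add[OF linear_W] linear_diff[OF linear_W]
  linear_scale[OF linear_W]

lemmas T_simps = linear_0[OF linear_T] linear_add[OF linear_T] linear_diff[OF linear_T]
  linear_scale[OF linear_T]

lemma W_commute: "W x \<bullet> y = W y \<bullet> x"
  by (metis W_sym inner_commute)

text \<open>By compactness of the Euclidean unit sphere of \<open>C\<close>, the Rayleigh quotient
  attains its minimum \<open>\<mu>\<close> there, and by homogeneity this bounds it on all of
  \<open>C\<close>. The minimizer is an eigenvector because the first variation vanishes.\<close>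

lemma rayleigh_minimizer:
  assumes C: "subspace C" and "C \<noteq> {0}" and inv: "\<And>x. x \<in> C \<Longrightarrow> T x \<in> C"
  obtains x \<mu> where "x \<in> C" "x \<noteq> 0" "T x = \<mu> *\<^sub>R x"
    "\<And>y. y \<in> C \<Longrightarrow> \<mu> * (W y \<bullet> y) \<le> W (T y) \<bullet> y"
proof -
  define q where "q y = (W (T y) \<bullet> y) / (W y \<bullet> y)" for y
  obtain u where u: "u \<in> C" "u \<noteq> 0"
    using \<open>C \<noteq> {0}\<close> subspace_0[OF C] by blast
  have "compact (sphere 0 1 \<inter> C)"
    by (intro compact_Int_closed compact_sphere closed_subspace C)
  moreover have "(1 / norm u) *\<^sub>R u \<in> sphere 0 1 \<inter> C"
    using u C by (auto simp: subspace_scale)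
  moreover have "continuous_on (sphere 0 1 \<inter> C) q"
  proof -
    have "continuous_on A W" "continuous_on A (\<lambda>y. W (T y))" for A
      using linear_continuous_on[of W A] linear_continuous_on[of "W \<circ> T" A]
        linear_W linear_T linear_compose[of T W]
      by (auto simp: linear_conv_bounded_linear o_def)
    moreover have "W y \<bullet> y \<noteq> 0" if "y \<in> sphere 0 1 \<inter> C" for y
      using that W_pos[of y] by (cases "y = 0") auto
    ultimately show ?thesis
      unfolding q_def by (intro continuous_intros) auto
  qed
  ultimately obtain x where x: "x \<in> C" "norm x = 1"
    and min: "\<And>y. y \<in> C \<Longrightarrow> norm y = 1 \<Longrightarrow> q x \<le> q y"
    using continuous_attains_inf[of "sphere 0 1 \<inter> C" q]
    by (metis IntE IntI empty_iff mem_sphere_0)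
  define \<mu> where "\<mu> = q x"
  have "x \<noteq> 0" using x by auto
  have ge: "\<mu> * (W y \<bullet> y) \<le> W (T y) \<bullet> y" if "y \<in> C" for y
  proof (cases "y = 0")
    case False
    have "q x \<le> q ((1 / norm y) *\<^sub>R y)"
      using min that C False by (auto simp: subspace_scale)
    also have "\<dots> = q y"
      using False by (simp add: q_def W_simps T_simps)
    finally show ?thesis
      using W_pos[OF False] by (simp add: \<mu>_def q_def field_simps)
  qed (simp add: W_simps T_simps)
  \<comment> \<open>The residual of the eigenvalue equation. Invariance of \<open>C\<close> under
    \<open>T\<close> makes it an admissible direction of variation.\<close>
  define z where "z = T x - \<mu> *\<^sub>R x"
  define b where "b y = W (T y) \<bullet> y - \<mu> * (W y \<bullet> y)" for y
  have "z \<in> C"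
    using x C inv by (simp add: z_def subspace_diff subspace_scale)
  have bx: "b x = 0"
    using W_pos[OF \<open>x \<noteq> 0\<close>] by (simp add: b_def \<mu>_def q_def)
  text \<open>\<open>b\<close> is nonnegative on \<open>C\<close> and vanishes at \<open>x\<close>, so its derivative at \<open>x\<close> in the direction
    \<open>z\<close>, which is \<open>2 (W z \<bullet> z)\<close>, vanishes too.\<close>
  have "2 * (W z \<bullet> z) = 0"
  proof (rule quadratic_nonneg_linear_coeff_zero)
    fix t :: real
    have "b (x + t *\<^sub>R z) = b x + t * (W (T x) \<bullet> z + W (T z) \<bullet> x - \<mu> * (W x \<bullet> z + W z \<bullet> x)) + t\<^sup>2 * b z"
      by (simp add: b_def W_simps T_simps inner_simps algebra_simps power2_eq_square)
    moreover have "W (T z) \<bullet> x = W (T x) \<bullet> z"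
      by (metis T_selfadjoint W_commute)
    moreover have "W z \<bullet> x = W x \<bullet> z"
      by (rule W_commute)
    moreover have "W (T x) \<bullet> z = W z \<bullet> z + \<mu> * (W x \<bullet> z)"
      by (subst (2) z_def) (simp add: W_simps inner_diff_left)
    moreover have "0 \<le> b (x + t *\<^sub>R z)"
      using ge[of "x + t *\<^sub>R z"] x(1) \<open>z \<in> C\<close> C
      by (simp add: b_def subspace_add subspace_scale)
    ultimately show "0 \<le> 2 * (W z \<bullet> z) * t + b z * t\<^sup>2"
      using bx by (simp only:) (simp add: algebra_simps)
  next
    show "0 \<le> b z"
      using ge[OF \<open>z \<in> C\<close>] by (simp add: b_def)
  qed
  then have "z = 0"
    using W_pos[of z] by auto
  then show ?thesis
    using that[of x \<mu>] x \<open>x \<noteq> 0\<close> ge by (simp add: z_def)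
qed

lemma eigenvectors_orthogonal:
  assumes "T x = \<mu> *\<^sub>R x" "T y = \<nu> *\<^sub>R y" "\<mu> \<noteq> \<nu>"
  shows "W x \<bullet> y = 0"
  using T_selfadjoint[of x y] assms by (simp add: W_simps)

text \<open>Choosing one eigenvector per eigenvalue gives a family that is orthogonal for the form,
  hence independent, hence finite.\<close>

lemma finite_eigenvalues: "finite (eigenvalues T)"
proof -
  define v where "v \<mu> = (SOME x. eigenfunction T \<mu> x)" for \<mu>
  have v: "v \<mu> \<noteq> 0" "T (v \<mu>) = \<mu> *\<^sub>R v \<mu>" if "\<mu> \<in> eigenvalues T" for \<mu>
  proof -
    have "eigenfunction T \<mu> (v \<mu>)"
      using that unfolding v_def eigenvalues_def by (auto intro: someI)
    then show "v \<mu> \<noteq> 0" "T (v \<mu>) = \<mu> *\<^sub>R v \<mu>"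
      by (simp_all add: eigenfunction_def)
  qed
  have inj: "inj_on v (eigenvalues T)"
  proof (rule inj_onI)
    fix \<mu> \<nu> assume *: "\<mu> \<in> eigenvalues T" "\<nu> \<in> eigenvalues T" "v \<mu> = v \<nu>"
    have "\<mu> *\<^sub>R v \<mu> = \<nu> *\<^sub>R v \<mu>"
      unfolding v(2)[OF *(1), symmetric] unfolding *(3) by (rule v(2)[OF *(2)])
    then show "\<mu> = \<nu>"
      using v(1)[OF *(1)] by (simp only: scaleR_cancel_right) blast
  qed
  have "independent (v ` eigenvalues T)"
    unfolding independent_explicit_module
  proof (intro allI impI)
    fix t u x
    assume t: "finite t" "t \<subseteq> v ` eigenvalues T" and sum: "(\<Sum>y\<in>t. u y *\<^sub>R y) = 0" and "x \<in> t"
    have "W x \<bullet> y = 0" if y: "y \<in> t - {x}" for y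
    proof -
      obtain \<mu> \<nu> where "\<mu> \<in> eigenvalues T" "x = v \<mu>" "\<nu> \<in> eigenvalues T" "y = v \<nu>"
        using y t(2) \<open>x \<in> t\<close> by blast
      then show ?thesis
        using y by (intro eigenvectors_orthogonal[of x \<mu> y \<nu>]) (auto intro: v(2))
    qed
    \<comment> \<open>Pairing the vanishing combination with \<open>W x\<close> isolates the
      coefficient of \<open>x\<close>.\<close>
    then have "W x \<bullet> (\<Sum>y\<in>t. u y *\<^sub>R y) = u x * (W x \<bullet> x)"
      using t(1) \<open>x \<in> t\<close> by (subst sum.remove[of t x]) (auto simp: inner_sum_right inner_add_right)
    moreover have "x \<noteq> 0"
      using t(2) \<open>x \<in> t\<close> v by auto
    ultimately show "u x = 0"
      using sum W_pos[of x] by auto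
  qed
  then show ?thesis
    using independent_imp_finite finite_imageD inj by blast
qed

section \<open>Orthogonal complements of sums of eigenspaces\<close>

definition eigenspaces_complement :: "real set \<Rightarrow> (real ^ 'v) set" where
  "eigenspaces_complement A = {x. \<forall>\<mu>\<in>A. \<forall>y\<in>eigenspace T \<mu>. W y \<bullet> x = 0}"

lemma subspace_eigenspaces_complement: "subspace (eigenspaces_complement A)"
  by (auto simp: subspace_def eigenspaces_complement_def inner_simps)

text \<open>Self-adjointness moves \<open>T\<close> onto the eigenvector in the other argument,
  where it acts as a scalar.\<close>

lemma eigenspaces_complement_invariant:
  assumes "x \<in> eigenspaces_complement A"
  shows "T x \<in> eigenspaces_complement A"
  using assms
  by (auto simp: eigenspaces_complement_def eigenspace_def T_selfadjoint[symmetric] W_simps)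

text \<open>The complement for the form is the Euclidean complement of the image under
  \<open>W\<close> of the eigenspaces, and a linear image does not increase dimension.\<close>

lemma dim_eigenspaces_complement:
  assumes "finite A"
  shows "CARD('v) \<le> dim (eigenspaces_complement A) + (\<Sum>\<mu>\<in>A. multiplicity_of T \<mu>)"
proof -
  define E where "E = (\<Union>\<mu>\<in>A. eigenspace T \<mu>)"
  have eq: "eigenspaces_complement A = {y \<in> UNIV. \<forall>x\<in>span (W ` E). orthogonal x y}"
    (is "_ = ?R")
  proof
    show "?R \<subseteq> eigenspaces_complement A"
      by (auto simp: eigenspaces_complement_def E_def orthogonal_def intro: span_base)
    show "eigenspaces_complement A \<subseteq> ?R"
    proof safe
      fix x y assume y: "y \<in> eigenspaces_complement A" and x: "x \<in> span (W ` E)"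
      have "orthogonal y x"
        by (rule orthogonal_to_span[OF x])
          (use y in \<open>auto simp: eigenspaces_complement_def E_def orthogonal_def inner_commute\<close>)
      then show "orthogonal x y" by (simp add: orthogonal_commute)
    qed simp
  qed
  have "dim (eigenspaces_complement A) + dim (span (W ` E)) = dim (UNIV :: (real ^ 'v) set)"
    unfolding eq by (rule dim_subspace_orthogonal_to_vectors) auto
  moreover have "dim (W ` E) \<le> dim E"
    using linear_W by (rule dim_image_le)
  moreover have "dim E \<le> (\<Sum>\<mu>\<in>A. multiplicity_of T \<mu>)"
    using dim_UN_le[OF assms, of "eigenspace T"] by (simp add: multiplicity_of_def E_def)
  ultimately show ?thesis by simp
qed

text \<open>Otherwise minimizing the Rayleigh quotient on this invariant subspace would yield an
  eigenvector orthogonal to its own eigenspace, hence to itself.\<close>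

lemma eigenspaces_complement_all: "eigenspaces_complement (eigenvalues T) = {0}"
proof (rule ccontr)
  assume "eigenspaces_complement (eigenvalues T) \<noteq> {0}"
  then obtain x \<mu> where x: "x \<in> eigenspaces_complement (eigenvalues T)" "x \<noteq> 0" "T x = \<mu> *\<^sub>R x"
    by (rule rayleigh_minimizer[OF subspace_eigenspaces_complement])
      (auto intro: eigenspaces_complement_invariant)
  then have "W x \<bullet> x = 0"
    unfolding eigenspaces_complement_def eigenvalues_def eigenspace_def eigenfunction_def by blast
  then show False
    using W_pos x(2) by fastforce
qed

text \<open>This guarantees that \<open>eigenvalue_list T\<close> has at least
  \<open>CARD('v)\<close> entries, so that its first \<open>CARD('v)\<close> indices are
  meaningful.\<close>

lemma sum_multiplicities: "CARD('v) \<le> (\<Sum>\<mu>\<in>eigenvalues T. multiplicity_of T \<mu>)"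
  using dim_eigenspaces_complement[OF finite_eigenvalues] eigenspaces_complement_all by simp

text \<open>The minimum on the complement is an eigenvalue with an eigenvector there. Were it \<le>
  \<kappa>, that eigenvector would be orthogonal to itself; hence the strict inequality.\<close>

lemma rayleigh_gt_on_complement:
  assumes "x \<in> eigenspaces_complement {\<mu> \<in> eigenvalues T. \<mu> \<le> \<kappa>}" (is "x \<in> ?C") and "x \<noteq> 0"
  shows "\<kappa> * (W x \<bullet> x) < W (T x) \<bullet> x"
proof -
  have "?C \<noteq> {0}" using assms by auto
  then obtain y \<mu> where y: "y \<in> ?C" "y \<noteq> 0" "T y = \<mu> *\<^sub>R y"
    and min: "\<And>z. z \<in> ?C \<Longrightarrow> \<mu> * (W z \<bullet> z) \<le> W (T z) \<bullet> z"
    by (rule rayleigh_minimizer[OF subspace_eigenspaces_complement])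
      (auto intro: eigenspaces_complement_invariant)
  have "\<not> \<mu> \<le> \<kappa>"
  proof
    assume "\<mu> \<le> \<kappa>"
    then have "W y \<bullet> y = 0"
      using y unfolding eigenspaces_complement_def eigenvalues_def eigenspace_def eigenfunction_def
      by blast
    then show False
      using W_pos y(2) by fastforce
  qed
  then have "\<kappa> * (W x \<bullet> x) < \<mu> * (W x \<bullet> x)"
    using W_pos[OF \<open>x \<noteq> 0\<close>] by simp
  then show ?thesis
    using min[OF assms(1)] by linarith
qed

text \<open>By the strict bound on the complement, \<open>F\<close> meets it only in 0, so the two
  dimensions add up to at most \<open>CARD('v)\<close>.\<close>

lemma dim_rayleigh_le:
  assumes F: "subspace F" and le: "\<And>x. x \<in> F \<Longrightarrow> W (T x) \<bullet> x \<le> \<kappa> * (W x \<bullet> x)"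
  shows "dim F \<le> (\<Sum>\<mu>\<in>{\<mu> \<in> eigenvalues T. \<mu> \<le> \<kappa>}. multiplicity_of T \<mu>)"
proof -
  let ?A = "{\<mu> \<in> eigenvalues T. \<mu> \<le> \<kappa>}"
  let ?C = "eigenspaces_complement ?A"
  have "F \<inter> ?C \<subseteq> {0}"
    using le rayleigh_gt_on_complement by force
  then have "dim (F \<inter> ?C) = 0"
    by (simp add: dim_eq_0)
  then have "dim {x + y |x y. x \<in> F \<and> y \<in> ?C} = dim F + dim ?C"
    using dim_sums_Int[OF F subspace_eigenspaces_complement, of ?A] by linarith
  moreover have "dim {x + y |x y. x \<in> F \<and> y \<in> ?C} \<le> CARD('v)"
    using dim_subset_UNIV[of "{x + y |x y. x \<in> F \<and> y \<in> ?C}"] by simp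
  ultimately show ?thesis
    using dim_eigenspaces_complement[of ?A] finite_eigenvalues by simp
qed

end

section \<open>Counting eigenvalues in the sorted list\<close>

lemma size_filter_sum_replicate_mset:
  assumes "finite A"
  shows "size (filter_mset P (\<Sum>\<mu>\<in>A. replicate_mset (m \<mu>) \<mu>)) = (\<Sum>\<mu>\<in>{\<mu> \<in> A. P \<mu>}. m \<mu>)"
  using assms
proof (induction A)
  case (insert a A)
  have "{\<mu> \<in> insert a A. P \<mu>} = (if P a then insert a {\<mu> \<in> A. P \<mu>} else {\<mu> \<in> A. P \<mu>})"
    by auto
  moreover have "filter_mset P (replicate_mset (m a) a) = (if P a then replicate_mset (m a) a else {#})"
    by (induction "m a") (auto simp: filter_mset_eq_conv)
  ultimately show ?case
    using insert by simp
qed simp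

text \<open>In a sorted list no entry from index \<open>k\<close> on is smaller than
  \<open>xs ! k\<close>, so all survivors come from \<open>take k xs\<close>.\<close>

lemma length_filter_less_nth_sorted:
  fixes xs :: "'a::linorder list"
  assumes "sorted xs" "k < length xs"
  shows "length (filter (\<lambda>x. x < xs ! k) xs) \<le> k"
proof -
  have "filter (\<lambda>x. x < xs ! k) (drop k xs) = []"
    using assms by (auto simp: filter_empty_conv in_set_conv_nth sorted_nth_mono not_less)
  then have "filter (\<lambda>x. x < xs ! k) xs = filter (\<lambda>x. x < xs ! k) (take k xs)"
    by (metis append_Nil2 append_take_drop_id filter_append)
  then show ?thesis
    using length_filter_le[of _ "take k xs"] by (metis length_take min.bounded_iff)
qed

lemma (in form_selfadjoint) sum_multiplicities_le_nth_eigenvalue: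
  assumes "1 \<le> k" "k \<le> CARD('v)"
  shows "(\<Sum>\<mu>\<in>{\<mu> \<in> eigenvalues T. \<mu> \<le> nth_eigenvalue T k}. multiplicity_of T \<mu>)
    \<le> k - 1 + multiplicity_of T (nth_eigenvalue T k)"
proof -
  let ?M = "\<Sum>\<mu>\<in>eigenvalues T. replicate_mset (multiplicity_of T \<mu>) \<mu>"
  let ?l = "nth_eigenvalue T k"
  have mset: "mset (eigenvalue_list T) = ?M"
    by (simp add: eigenvalue_list_def)
  have "length (eigenvalue_list T) = (\<Sum>\<mu>\<in>eigenvalues T. multiplicity_of T \<mu>)"
    using size_filter_sum_replicate_mset[OF finite_eigenvalues, of "\<lambda>_. True" "multiplicity_of T"]
    by (simp flip: mset)
  \<comment> \<open>List indices start at 0, so the \<open>k\<close>-th eigenvalue sits at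
    \<open>k - 1\<close>, which must be a valid index.\<close>
  then have "k - 1 < length (eigenvalue_list T)"
    using sum_multiplicities assms by simp
  then have "length (filter (\<lambda>x. x < ?l) (eigenvalue_list T)) \<le> k - 1"
    unfolding nth_eigenvalue_def
    by (intro length_filter_less_nth_sorted) (simp_all add: eigenvalue_list_def)
  then have "size (filter_mset (\<lambda>x. x < ?l) ?M) \<le> k - 1"
    by (metis mset mset_filter size_mset)
  then have less: "(\<Sum>\<mu>\<in>{\<mu> \<in> eigenvalues T. \<mu> < ?l}. multiplicity_of T \<mu>) \<le> k - 1"
    by (simp add: size_filter_sum_replicate_mset finite_eigenvalues)
  have "(\<Sum>\<mu>\<in>{\<mu> \<in> eigenvalues T. \<mu> \<le> ?l}. multiplicity_of T \<mu>)
      \<le> (\<Sum>\<mu>\<in>insert ?l {\<mu> \<in> eigenvalues T. \<mu> < ?l}. multiplicity_of T \<mu>)"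
    by (rule sum_mono2) (auto simp: finite_eigenvalues)
  also have "\<dots> = multiplicity_of T ?l + (\<Sum>\<mu>\<in>{\<mu> \<in> eigenvalues T. \<mu> < ?l}. multiplicity_of T \<mu>)"
    by (simp add: finite_eigenvalues)
  finally show ?thesis
    using less by linarith
qed

section \<open>The Laplacian\<close>

text \<open>The diagonal operator representing the degree-weighted inner product, in the role of
  \<open>W\<close>.\<close>

definition deg_weight :: "'v::finite hyperedge set \<Rightarrow> real ^ 'v \<Rightarrow> real ^ 'v" where
  "deg_weight H f = (\<chi> i. real (deg H i) * f $ i)"

lemma inner_deg_weight: "deg_weight H f \<bullet> g = (\<Sum>i\<in>UNIV. real (deg H i) * f $ i * g $ i)"
  by (simp add: deg_weight_def inner_vec_def)

lemma linear_edge_diff: "linear (edge_diff h)"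
  by (rule linearI)
    (simp_all add: edge_diff_def sum.distrib sum_distrib_left right_diff_distrib)

lemma linear_laplacian: "linear (laplacian H)"
  by (rule linearI)
    (simp_all add: laplacian_def vec_eq_iff linear_add[OF linear_edge_diff]
      linear_scale[OF linear_edge_diff] sum.distrib sum_distrib_left algebra_simps)

text \<open>The weight cancels the factor \<open>1 / deg\<close>, and exchanging the sums over
  vertices and hyperedges collects the signed values of \<open>g\<close> into
  \<open>edge_diff h g\<close>. The result is symmetric in \<open>f\<close> and \<open>g\<close>,
  which yields self-adjointness.\<close>

lemma deg_weight_laplacian:
  fixes H :: "'v::finite hyperedge set"
  assumes "\<forall>i. deg H i \<noteq> 0"
  shows "deg_weight H (laplacian H f) \<bullet> g = (\<Sum>h\<in>H. edge_diff h f * edge_diff h g)"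
proof -
  have fin: "finite H" by simp
  have swap: "(\<Sum>i\<in>UNIV. (\<Sum>h\<in>{h \<in> H. i \<in> s h}. edge_diff h f) * g $ i)
      = (\<Sum>h\<in>H. edge_diff h f * (\<Sum>i\<in>s h. g $ i))" for s :: "'v hyperedge \<Rightarrow> 'v set"
  proof -
    have "(\<Sum>i\<in>UNIV. (\<Sum>h\<in>{h \<in> H. i \<in> s h}. edge_diff h f) * g $ i)
        = (\<Sum>i\<in>UNIV. \<Sum>h\<in>{h \<in> H. i \<in> s h}. edge_diff h f * g $ i)"
      by (simp add: sum_distrib_right)
    also have "\<dots> = (\<Sum>h\<in>H. \<Sum>i\<in>{i \<in> UNIV. i \<in> s h}. edge_diff h f * g $ i)"
      by (rule sum.swap_restrict) (simp_all add: fin)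
    finally show ?thesis by (simp add: sum_distrib_left)
  qed
  have "deg_weight H (laplacian H f) \<bullet> g
      = (\<Sum>i\<in>UNIV. (\<Sum>h\<in>{h \<in> H. i \<in> fst h}. edge_diff h f) * g $ i)
        - (\<Sum>i\<in>UNIV. (\<Sum>h\<in>{h \<in> H. i \<in> snd h}. edge_diff h f) * g $ i)"
    using assms by (simp add: inner_deg_weight laplacian_def left_diff_distrib sum_subtractf)
  also have "\<dots> = (\<Sum>h\<in>H. edge_diff h f * edge_diff h g)"
    unfolding swap by (simp add: edge_diff_def[of _ g] right_diff_distrib sum_subtractf)
  finally show ?thesis .
qed

lemma form_selfadjoint_laplacian:
  fixes H :: "'v::finite hyperedge set"
  assumes "\<forall>i. deg H i \<noteq> 0"
  shows "form_selfadjoint (deg_weight H) (laplacian H)"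
proof (rule form_selfadjoint.intro)
  show "linear (deg_weight H)"
    by (rule linearI) (simp_all add: deg_weight_def vec_eq_iff algebra_simps)
  show "linear (laplacian H)" by (rule linear_laplacian)
  show sym: "deg_weight H x \<bullet> y = x \<bullet> deg_weight H y" for x y
    by (simp add: inner_commute[of x] inner_deg_weight ac_simps)
  show "0 < deg_weight H x \<bullet> x" if nz: "x \<noteq> 0" for x
  proof -
    obtain i where "x $ i \<noteq> 0"
      using nz by (auto simp: vec_eq_iff)
    then have "0 < real (deg H i) * x $ i * x $ i"
      using assms by (auto simp: mult.assoc zero_less_mult_iff linorder_neq_iff)
    moreover have "0 \<le> real (deg H j) * x $ j * x $ j" for j
      by (simp add: mult.assoc)
    ultimately show ?thesis
      unfolding inner_deg_weight by (intro sum_pos2[of UNIV i]) auto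
  qed
  show "deg_weight H (laplacian H x) \<bullet> y = deg_weight H x \<bullet> laplacian H y" for x y
  proof -
    have "deg_weight H x \<bullet> laplacian H y = deg_weight H (laplacian H y) \<bullet> x"
      by (metis sym inner_commute)
    then show ?thesis
      by (simp add: deg_weight_laplacian[OF assms] mult.commute)
  qed
qed

section \<open>Nodal domains\<close>

text \<open>Paths inside the two sets are joined through the link from \<open>x\<close> to
  \<open>y\<close>. The case \<open>x = y\<close> serves overlapping components, the other case the
  addition of a vertex along a hyperedge.\<close>

lemma connected_on_Un:
  assumes S: "connected_on K S" and S': "connected_on K S'" and x: "x \<in> S" and y: "y \<in> S'"
    and xy: "x = y \<or> (\<exists>h\<in>K. x \<in> h \<and> y \<in> h)"
  shows "connected_on K (S \<union> S')"
proof -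
  define R where "R A = {(u, v). u \<in> A \<and> v \<in> A \<and> (\<exists>h\<in>K. u \<in> h \<and> v \<in> h)}" for A
  have mono: "(R A)\<^sup>* \<subseteq> (R B)\<^sup>*" if "A \<subseteq> B" for A B
    by (rule rtrancl_mono) (use that in \<open>auto simp: R_def\<close>)
  have con: "connected_on K A \<longleftrightarrow> (\<forall>u\<in>A. \<forall>v\<in>A. (u, v) \<in> (R A)\<^sup>*)" for A
    by (simp add: connected_on_def R_def)
  have "(x, y) \<in> (R (S \<union> S'))\<^sup>*" "(y, x) \<in> (R (S \<union> S'))\<^sup>*"
    using x y xy by (auto simp: R_def)
  moreover have "(u, v) \<in> (R (S \<union> S'))\<^sup>*" if "u \<in> S \<and> v \<in> S \<or> u \<in> S' \<and> v \<in> S'" for u v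
    using that S S' mono[of S "S \<union> S'"] mono[of S' "S \<union> S'"] unfolding con by blast
  ultimately have "(u, v) \<in> (R (S \<union> S'))\<^sup>*" if "u \<in> S \<union> S'" "v \<in> S \<union> S'" for u v
    using that x y rtrancl_trans[of u x] rtrancl_trans[of u y] rtrancl_trans[of x y _ v]
      rtrancl_trans[of y x _ v]
    by (metis Un_iff)
  then show ?thesis
    unfolding con by blast
qed

text \<open>Adding \<open>j\<close> to \<open>S\<close> preserves connectedness, since
  \<open>h\<close> links it to \<open>i\<close>; maximality then forces \<open>j\<close> into
  \<open>S\<close>.\<close>

lemma nodal_domain_edge_closed:
  assumes S: "S \<in> nodal_domains H f" and "h \<in> H" and "i \<in> S \<inter> verts h" and "j \<in> supp f \<inter> verts h"
  shows "j \<in> S"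
proof -
  let ?K = "(\<lambda>h. verts h \<inter> supp f) ` H"
  have *: "S \<subseteq> supp f" "connected_on ?K S"
    and max: "\<And>S'. S \<subseteq> S' \<Longrightarrow> S' \<subseteq> supp f \<Longrightarrow> connected_on ?K S' \<Longrightarrow> S' = S"
    using S by (auto simp: nodal_domains_def connected_comps_def)
  have "connected_on ?K (S \<union> {j})"
    by (rule connected_on_Un[of _ _ _ i j])
      (use assms * in \<open>auto simp: connected_on_def\<close>)
  then have "S \<union> {j} = S"
    using max[of "S \<union> {j}"] * assms by auto
  then show ?thesis by blast
qed

lemma nodal_domains_disjoint:
  assumes "S \<in> nodal_domains H f" "S' \<in> nodal_domains H f" "i \<in> S" "i \<in> S'"
  shows "S = S'"
proof -
  let ?K = "(\<lambda>h. verts h \<inter> supp f) ` H"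
  have con: "connected_on ?K (S \<union> S')"
    by (rule connected_on_Un[of _ _ _ i i])
      (use assms in \<open>auto simp: nodal_domains_def connected_comps_def\<close>)
  have supp: "S \<union> S' \<subseteq> supp f"
    using assms(1,2) by (auto simp: nodal_domains_def connected_comps_def)
  have max: "B = A" if "A \<in> nodal_domains H f" "A \<subseteq> B" "B \<subseteq> supp f" "connected_on ?K B" for A B
    using that by (simp add: nodal_domains_def connected_comps_def)
  have "S \<union> S' = S"
    by (rule max[OF assms(1) _ supp con]) simp
  moreover have "S \<union> S' = S'"
    by (rule max[OF assms(2) _ supp con]) simp
  ultimately show ?thesis by (rule trans[OF sym])
qed

section \<open>Restrictions of an eigenfunction to its nodal domains\<close>

definition vec_restrict :: "'v set \<Rightarrow> real ^ 'v \<Rightarrow> real ^ 'v" where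
  "vec_restrict S f = (\<chi> i. if i \<in> S then f $ i else 0)"

lemma edge_diff_vec_restrict_disjoint:
  assumes "S \<inter> verts h = {}"
  shows "edge_diff h (vec_restrict S f) = 0"
proof -
  have "i \<notin> S" if "i \<in> fst h \<or> i \<in> snd h" for i
    using that assms by (auto simp: verts_def)
  then show ?thesis
    by (simp add: edge_diff_def vec_restrict_def)
qed

text \<open>A hyperedge meeting \<open>S\<close> has all its support vertices in \<open>S\<close>,
  so the vertices cut off by the restriction are zeros of \<open>f\<close>.\<close>

lemma edge_diff_vec_restrict_nodal_domain:
  assumes "S \<in> nodal_domains H f" "h \<in> H" "S \<inter> verts h \<noteq> {}"
  shows "edge_diff h (vec_restrict S f) = edge_diff h f"
proof -
  have "vec_restrict S f $ i = f $ i" if "i \<in> fst h \<or> i \<in> snd h" for i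
    using that nodal_domain_edge_closed[OF assms(1,2)] assms(3)
    by (auto simp: vec_restrict_def verts_def supp_def)
  then show ?thesis
    by (simp add: edge_diff_def)
qed

text \<open>For equal domains one factor per hyperedge may be replaced by that of \<open>f\<close>,
  which brings in the eigenvalue equation. For distinct domains both sides vanish, since no
  hyperedge meets both and the supports are disjoint.\<close>

lemma laplacian_form_vec_restrict:
  assumes deg: "\<forall>i. deg H i \<noteq> 0" and eig: "laplacian H f = \<kappa> *\<^sub>R f"
    and S: "S \<in> nodal_domains H f" and S': "S' \<in> nodal_domains H f"
  shows "deg_weight H (laplacian H (vec_restrict S f)) \<bullet> vec_restrict S' f
    = \<kappa> * (deg_weight H (vec_restrict S f) \<bullet> vec_restrict S' f)"
proof (cases "S = S'")
  case True
  have "deg_weight H (laplacian H (vec_restrict S f)) \<bullet> vec_restrict S f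
      = (\<Sum>h\<in>H. edge_diff h f * edge_diff h (vec_restrict S f))"
    unfolding deg_weight_laplacian[OF deg]
  proof (rule sum.cong)
    fix h assume "h \<in> H"
    then show "edge_diff h (vec_restrict S f) * edge_diff h (vec_restrict S f)
        = edge_diff h f * edge_diff h (vec_restrict S f)"
      using edge_diff_vec_restrict_disjoint[of S h f] edge_diff_vec_restrict_nodal_domain[OF S]
      by (cases "S \<inter> verts h = {}") auto
  qed simp
  also have "\<dots> = deg_weight H (laplacian H f) \<bullet> vec_restrict S f"
    by (simp add: deg_weight_laplacian[OF deg])
  also have "\<dots> = \<kappa> * (deg_weight H (vec_restrict S f) \<bullet> vec_restrict S f)"
    unfolding eig inner_deg_weight sum_distrib_left
    by (rule sum.cong) (simp_all add: vec_restrict_def)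
  finally show ?thesis
    using True by simp
next
  case False
  have disj: "i \<notin> S'" if "i \<in> S" for i
    using that False nodal_domains_disjoint[OF S S'] by blast
  have supp': "S' \<subseteq> supp f"
    using S' by (auto simp: nodal_domains_def connected_comps_def)
  have "edge_diff h (vec_restrict S f) * edge_diff h (vec_restrict S' f) = 0" if "h \<in> H" for h
  proof -
    have "S \<inter> verts h = {} \<or> S' \<inter> verts h = {}"
      using nodal_domain_edge_closed[OF S that] disj supp' by blast
    then show ?thesis
      by (auto simp: edge_diff_vec_restrict_disjoint)
  qed
  then have "deg_weight H (laplacian H (vec_restrict S f)) \<bullet> vec_restrict S' f = 0"
    unfolding deg_weight_laplacian[OF deg] by (rule sum.neutral[OF ballI])
  moreover have "deg_weight H (vec_restrict S f) \<bullet> vec_restrict S' f = 0"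
    unfolding inner_deg_weight
    by (rule sum.neutral) (use disj in \<open>auto simp: vec_restrict_def\<close>)
  ultimately show ?thesis by simp
qed

text \<open>The restrictions are nonzero with disjoint supports, hence pairwise orthogonal and
  independent.\<close>

lemma dim_nodal_restrictions:
  fixes f :: "real ^ 'v::finite"
  shows "dim ((\<lambda>S. vec_restrict S f) ` nodal_domains H f) = card (nodal_domains H f)"
proof -
  let ?N = "nodal_domains H f"
  let ?B = "(\<lambda>S. vec_restrict S f) ` ?N"
  have nz: "vec_restrict S f \<noteq> 0" if S: "S \<in> ?N" for S
  proof -
    obtain i where "i \<in> S" "f $ i \<noteq> 0"
      using S unfolding nodal_domains_def connected_comps_def supp_def by blast
    then show ?thesis
      by (auto simp: vec_eq_iff vec_restrict_def)
  qed
  have orth: "vec_restrict S f \<bullet> vec_restrict S' f = 0" if "S \<in> ?N" "S' \<in> ?N" "S \<noteq> S'" for S S'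
    unfolding inner_vec_def
    by (rule sum.neutral)
      (use that nodal_domains_disjoint[OF that(1,2)] in \<open>auto simp: vec_restrict_def\<close>)
  have "inj_on (\<lambda>S. vec_restrict S f) ?N"
  proof (rule inj_onI, rule ccontr)
    fix S S' assume *: "S \<in> ?N" "S' \<in> ?N" "vec_restrict S f = vec_restrict S' f" "S \<noteq> S'"
    then have "vec_restrict S f \<bullet> vec_restrict S f = 0"
      using orth[of S S'] by simp
    then show False
      using nz[OF *(1)] by simp
  qed
  then have "card ?B = card ?N"
    by (rule card_image)
  moreover have "independent ?B"
  proof (rule pairwise_orthogonal_independent)
    show "pairwise orthogonal ?B"
      using orth by (auto simp: pairwise_def orthogonal_def)
    show "0 \<notin> ?B" using nz by auto
  qed
  ultimately show ?thesis
    using dim_eq_card_independent by metis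
qed

text \<open>Bilinearity, applied to one argument at a time: first \<open>y\<close> ranges over the
  span, then \<open>x\<close>.\<close>

lemma inner_linear_zero_on_span:
  fixes M :: "'a::euclidean_space \<Rightarrow> 'a"
  assumes M: "linear M" and zero: "\<And>x y. x \<in> B \<Longrightarrow> y \<in> B \<Longrightarrow> M x \<bullet> y = 0"
    and x: "x \<in> span B" and y: "y \<in> span B"
  shows "M x \<bullet> y = 0"
proof -
  have B: "orthogonal (M z) y" if "z \<in> B" for z
    by (rule orthogonal_to_span[OF y]) (simp add: zero that orthogonal_def)
  have "M x \<in> span (M ` B)"
    using x linear_span_image[OF M] by blast
  then have "orthogonal y (M x)"
    by (rule orthogonal_to_span) (use B in \<open>auto simp: orthogonal_commute\<close>)
  then show ?thesis
    by (simp add: orthogonal_def inner_commute)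
qed

theorem theorem1:
  fixes H :: "'v::finite hyperedge set" and f :: "real ^ 'v" and k r :: nat
  assumes "oriented_hypergraph H"
    and "\<forall>i. deg H i \<noteq> 0"
    and "1 \<le> k" and "k \<le> CARD('v)"
    and "eigenfunction (laplacian H) (nth_eigenvalue (laplacian H) k) f"
    and "multiplicity_of (laplacian H) (nth_eigenvalue (laplacian H) k) = r"
  shows "card (nodal_domains H f) \<le> k + r - 1"
proof -
  let ?T = "laplacian H" and ?W = "deg_weight H"
  let ?\<kappa> = "nth_eigenvalue ?T k"
  let ?B = "(\<lambda>S. vec_restrict S f) ` nodal_domains H f"
  interpret form_selfadjoint ?W ?T
    by (rule form_selfadjoint_laplacian) fact
  \<comment> \<open>The form of \<open>?M\<close> measures how far the Rayleigh quotient is from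
    \<open>?\<kappa>\<close>; it has only to be checked on pairs from \<open>?B\<close>.\<close>
  let ?M = "\<lambda>x. ?W (?T x) - ?\<kappa> *\<^sub>R ?W x"
  have eig: "?T f = ?\<kappa> *\<^sub>R f"
    using assms(5) by (simp add: eigenfunction_def)
  have "linear ?M"
    by (rule linearI) (simp_all add: W_simps T_simps algebra_simps)
  moreover have "?M x \<bullet> y = 0" if "x \<in> ?B" "y \<in> ?B" for x y
    using that laplacian_form_vec_restrict[OF assms(2) eig] by (auto simp: inner_diff_left)
  ultimately have "?M x \<bullet> x = 0" if "x \<in> span ?B" for x
    using inner_linear_zero_on_span[of ?M ?B x x] that by blast
  then have "?W (?T x) \<bullet> x \<le> ?\<kappa> * (?W x \<bullet> x)" if "x \<in> span ?B" for x
    using that by (simp add: inner_diff_left)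
  then have "dim (span ?B) \<le> (\<Sum>\<mu>\<in>{\<mu> \<in> eigenvalues ?T. \<mu> \<le> ?\<kappa>}. multiplicity_of ?T \<mu>)"
    by (rule dim_rayleigh_le[OF subspace_span])
  also have "\<dots> \<le> k - 1 + r"
    using sum_multiplicities_le_nth_eigenvalue[OF assms(3,4)] assms(6) by simp
  \<comment> \<open>Since \<open>1 \<le> k\<close>, truncated subtraction gives
    \<open>k - 1 + r = k + r - 1\<close>.\<close>
  finally show ?thesis
    using assms(3) by (simp add: dim_nodal_restrictions)
qed

end
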